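(* Let $-\infty<a<b\leq\infty$ and let $\underline{u}:\mathbb{B}_2\rightarrow(a,b)^2$ be a pluriharmonic function. Then $$\mathrm{Kob}_{S(a,b)^2}(\underline{u}(z),\underline{u}(w))\leq\mathrm{Kob}_{\mathbb{B}_2}(z,w),\qquad z,w\in\mathbb{B}_2 .$$
   Context: $\mathbb{B}_2$ is the open unit ball of $\mathbb{C}^2$; $S(a,b)=(a,b)\times\mathbb{R}=\{w\in\mathbb{C}:a<\operatorname{Re}w<b\}$, and $(a,b)^2\subset\mathbb{R}^2$ is regarded as a subset of $S(a,b)^2\subset\mathbb{C}^2$. A map into $(a,b)^2$ is pluriharmonic if each of its two real components is a pluriharmonic function. For a domain $G\subset\mathbb{C}^n$, $p\in G$ and $v\in T_pG$, the Kobayashi–Finsler norm is $k_G(p,v)=\inf|h|$ over all $h\in T_0\mathbb{C}\cong\mathbb{C}$ for which there is a holomorphic $\phi:\mathbb{U}\to G$ ($\mathbb{U}$ the open unit disk) with $\phi(0)=p$ and $d\phi_0(h)=v$. With two points as arguments, $\mathrm{Kob}_G(z,w)=\inf_\gamma\int_0^1k_G(\gamma(t),\dot\gamma(t))\,dt$, the infimum being over all piecewise smooth paths $\gamma:[0,1]\to G$ with $\gamma(0)=z$, $\gamma(1)=w$. *)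

theory Defs
  imports "HOL-Analysis.Analysis"
begin

text \<open>
  \<open>\<complex>\<^sup>n\<close> is rendered as \<open>complex ^ 'n\<close>; its norm is the Euclidean one, so \<open>ball 0 1\<close> in
  \<open>complex ^ 2\<close> is the open unit ball of \<open>\<complex>\<^sup>2\<close>.
\<close>

definition holomorphic_vec_on :: "(complex \<Rightarrow> complex ^ 'n::finite) \<Rightarrow> complex set \<Rightarrow> bool" where
  "holomorphic_vec_on \<phi> U \<longleftrightarrow> (\<forall>i. (\<lambda>\<zeta>. \<phi> \<zeta> $ i) holomorphic_on U)"

text \<open>
  The Kobayashi--Finsler norm. Both it and the Kobayashi distance below are valued in
  \<^typ>\<open>ennreal\<close>, so that the infimum of an empty set would be \<open>\<infinity>\<close>; for a domain \<open>G\<close>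
  all the values are finite. A holomorphic \<open>\<phi>\<close> is real differentiable at \<open>0\<close>, so
  \<^const>\<open>frechet_derivative\<close> is its genuine differential there.
\<close>

definition kobayashi_norm ::
    "(complex ^ 'n::finite) set \<Rightarrow> complex ^ 'n \<Rightarrow> complex ^ 'n \<Rightarrow> ennreal" where
  "kobayashi_norm G p v =
     Inf {ennreal (cmod h) | h. \<exists>\<phi>. holomorphic_vec_on \<phi> (ball 0 1) \<and> \<phi> ` ball 0 1 \<subseteq> G \<and>
                                    \<phi> 0 = p \<and> frechet_derivative \<phi> (at 0) h = v}"

text \<open>
  For open \<open>G\<close> the norm is upper semicontinuous in \<open>(p, v)\<close>, so the integrand is Borel off the
  finitely many break points of \<open>\<gamma>\<close>, and the nonnegative integral is the usual one. The values of
  \<^const>\<open>vector_derivative\<close> at the break points lie over a null set. Finally, \<^const>\<open>valid_path\<close>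
  means continuous and \<open>C\<^sup>1\<close> off a finite set, where the derivative may be unbounded near a
  break point; this does not change the infimum, because a short piece of \<open>\<gamma>\<close> around a break point
  can be replaced by line segments whose lengths are arbitrarily small.
\<close>

definition Kob :: "(complex ^ 'n::finite) set \<Rightarrow> complex ^ 'n \<Rightarrow> complex ^ 'n \<Rightarrow> ennreal" where
  "Kob G z w =
     Inf {\<integral>\<^sup>+ t \<in> {0..1}. kobayashi_norm G (\<gamma> t) (vector_derivative \<gamma> (at t)) \<partial>lborel | \<gamma>.
            valid_path \<gamma> \<and> path_image \<gamma> \<subseteq> G \<and> pathstart \<gamma> = z \<and> pathfinish \<gamma> = w}"

definition strip :: "ereal \<Rightarrow> ereal \<Rightarrow> complex set" where
  "strip a b = {w. a < ereal (Re w) \<and> ereal (Re w) < b}"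

definition strip_square :: "ereal \<Rightarrow> ereal \<Rightarrow> (complex ^ 2) set" where
  "strip_square a b = {\<zeta>. \<forall>i. \<zeta> $ i \<in> strip a b}"

definition interval_square :: "ereal \<Rightarrow> ereal \<Rightarrow> (real ^ 2) set" where
  "interval_square a b = {x. \<forall>i. x $ i \<in> einterval a b}"

definition complexify :: "real ^ 'n::finite \<Rightarrow> complex ^ 'n" where
  "complexify x = (\<chi> i. complex_of_real (x $ i))"

definition C2_on :: "('a::real_normed_vector \<Rightarrow> 'b::real_normed_vector) \<Rightarrow> 'a set \<Rightarrow> bool" where
  "C2_on f U \<longleftrightarrow>
     (\<exists>(f' :: 'a \<Rightarrow> 'a \<Rightarrow>\<^sub>L 'b) (f'' :: 'a \<Rightarrow> 'a \<Rightarrow>\<^sub>L ('a \<Rightarrow>\<^sub>L 'b)).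
        (\<forall>x\<in>U. (f has_derivative blinfun_apply (f' x)) (at x)) \<and>
        (\<forall>x\<in>U. (f' has_derivative blinfun_apply (f'' x)) (at x)) \<and>
        continuous_on U f'')"

text \<open>
  On \<^typ>\<open>complex\<close> the orthonormal basis \<^const>\<open>Basis\<close> is \<open>{1, \<i>}\<close>, so this is
  \<open>f\<^sub>x\<^sub>x + f\<^sub>y\<^sub>y\<close>.
\<close>

definition laplacian :: "('a::euclidean_space \<Rightarrow> real) \<Rightarrow> 'a \<Rightarrow> real" where
  "laplacian f x = (\<Sum>e\<in>Basis. (deriv ^^ 2) (\<lambda>t. f (x + t *\<^sub>R e)) 0)"

definition harmonic_on :: "('a::euclidean_space \<Rightarrow> real) \<Rightarrow> 'a set \<Rightarrow> bool" where
  "harmonic_on f U \<longleftrightarrow> open U \<and> C2_on f U \<and> (\<forall>x\<in>U. laplacian f x = 0)"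

text \<open>
  A \<open>C\<^sup>2\<close> function on an open set is pluriharmonic if its restriction to every complex line
  \<open>\<zeta> \<mapsto> p + \<zeta> v\<close> is harmonic where it is defined.
\<close>

definition pluriharmonic_on :: "(complex ^ 'n::finite \<Rightarrow> real) \<Rightarrow> (complex ^ 'n) set \<Rightarrow> bool" where
  "pluriharmonic_on f \<Omega> \<longleftrightarrow>
     open \<Omega> \<and> C2_on f \<Omega> \<and>
     (\<forall>p v. harmonic_on (\<lambda>\<zeta>. f (p + \<zeta> *s v)) {\<zeta>. p + \<zeta> *s v \<in> \<Omega>})"

end

theory Submission
  imports Defs "HOL-Complex_Analysis.Cauchy_Integral_Formula"
begin

text \<open>
  It suffices to compare the Kobayashi norms infinitesimally, since a path in the ball is mapped by
  \<open>u\<close> to a path in the square. Let \<open>\<phi>\<close> be a disc in the ball with \<open>\<phi> 0 = p\<close> and \<open>d\<phi>\<^sub>0 h = v\<close>.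
  Each \<open>u\<^sub>i \<circ> \<phi>\<close> is harmonic, hence the real part of a holomorphic \<open>\<psi>\<^sub>i\<close> on the disc with \<open>\<psi>\<^sub>i 0\<close> real.
  The disc \<open>\<psi>\<close> has tangent \<open>\<psi>' 0 * h\<close>, whose real part is \<open>du\<^sub>p v\<close>; since the strip is a product,
  its coordinates can be rescaled separately by constants of modulus at most \<open>1\<close> that make the
  tangent real, at no cost in \<open>\<bar>h\<bar>\<close>.
\<close>

section \<open>Symmetry of the second derivative\<close>

text \<open>The second difference over a parallelogram is a difference in direction \<open>w\<close>
  of increments in direction \<open>v\<close>. The mean value theorem turns the increments into
  values of \<open>f'\<close>, and \<open>approx\<close>, the differentiability of \<open>f'\<close>
  at \<open>x\<close> with tolerance \<open>e\<close>, replaces these by \<open>D\<close>. The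
  second difference does not change when \<open>v\<close> and \<open>w\<close> are interchanged,
  which is what the estimate is for.\<close>

lemma second_difference_estimate:
  fixes f :: "'a::real_normed_vector \<Rightarrow> real" and f' :: "'a \<Rightarrow> 'a \<Rightarrow>\<^sub>L real"
  assumes der: "\<And>y. y \<in> ball x d \<Longrightarrow> (f has_derivative blinfun_apply (f' y)) (at y)"
    and approx: "\<And>y. y \<in> ball x d \<Longrightarrow> norm (f' y - f' x - D (y - x)) \<le> e * norm (y - x)"
    and D: "linear D" and "0 \<le> e" "0 < s" and s: "s * (norm v + norm w) < d"
  shows "\<bar>f (x + s *\<^sub>R v + s *\<^sub>R w) - f (x + s *\<^sub>R v) - f (x + s *\<^sub>R w) + f x
           - s\<^sup>2 * blinfun_apply (D w) v\<bar> \<le> 2 * e * s\<^sup>2 * (norm v + norm w)\<^sup>2"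
proof -
  define M where "M = norm v + norm w"
  have M: "norm v \<le> M" "norm w \<le> M" "0 \<le> M"
    by (auto simp: M_def)
  \<comment> \<open>\<open>r\<close> runs along an edge in direction \<open>v\<close>;
    \<open>k\<close> selects the edge, starting at \<open>x\<close> for \<open>k = 0\<close> and at
    \<open>x + s *\<^sub>R w\<close> for \<open>k = 1\<close>.\<close>
  define y where "y k r = x + (s * r) *\<^sub>R v + (s * k) *\<^sub>R w" for k r :: real
  have y_norm: "norm (y k r - x) \<le> s * M" if "r \<in> {0..1}" "k \<in> {0..1}" for k r
  proof -
    have "norm (y k r - x) = norm (s *\<^sub>R (r *\<^sub>R v + k *\<^sub>R w))"
      by (simp add: y_def algebra_simps)
    also have "\<dots> \<le> s * (r * norm v + k * norm w)"
      using norm_triangle_ineq[of "r *\<^sub>R v" "k *\<^sub>R w"] that \<open>0 < s\<close> by (simp add: mult_left_mono)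
    also have "\<dots> \<le> s * (1 * norm v + 1 * norm w)"
      using that \<open>0 < s\<close> by (intro mult_left_mono add_mono mult_right_mono) auto
    finally show ?thesis by (simp add: M_def)
  qed
  have y_ball: "y k r \<in> ball x d" if "r \<in> {0..1}" "k \<in> {0..1}" for k r
    using y_norm[OF that] s by (simp add: M_def dist_norm norm_minus_commute)
  have fy: "((\<lambda>r. f (y k r)) has_derivative (\<lambda>h. f' (y k r) ((s * h) *\<^sub>R v))) (at r within {0..1})"
    if "r \<in> {0..1}" "k \<in> {0..1}" for k r
  proof -
    have "(y k has_derivative (\<lambda>h. (s * h) *\<^sub>R v)) (at r within {0..1})"
      unfolding y_def by (auto intro!: derivative_eq_intros)
    from has_derivative_compose[OF this der[OF y_ball[OF that]]] show ?thesis .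
  qed
  \<comment> \<open>The mean value theorem is applied to the difference of \<open>f\<close> along
    the two edges, so that a single \<open>r\<close> serves both.\<close>
  obtain r where r: "r \<in> {0<..<1}"
    and mv: "(f (y 1 1) - f (y 0 1)) - (f (y 1 0) - f (y 0 0))
             = f' (y 1 r) ((s * (1 - 0)) *\<^sub>R v) - f' (y 0 r) ((s * (1 - 0)) *\<^sub>R v)"
    using mvt_simple[of 0 1 "\<lambda>r. f (y 1 r) - f (y 0 r)"
        "\<lambda>r h. f' (y 1 r) ((s * h) *\<^sub>R v) - f' (y 0 r) ((s * h) *\<^sub>R v)"]
      has_derivative_diff[OF fy fy] by auto
  \<comment> \<open>The error of the linear approximation of \<open>f'\<close> at
    \<open>y k r\<close>. Between \<open>k = 0\<close> and \<open>k = 1\<close> the value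
    \<open>f' x\<close> and the displacement along \<open>v\<close> cancel, so only
    \<open>s *\<^sub>R D w\<close> and the two errors remain.\<close>
  define R where "R k = f' (y k r) - f' x - D (y k r - x)" for k
  have R: "norm (R k) \<le> e * (s * M)" if "k \<in> {0..1}" for k
  proof -
    have "norm (R k) \<le> e * norm (y k r - x)"
      unfolding R_def using approx y_ball that r by simp
    also have "\<dots> \<le> e * (s * M)"
      using y_norm that r \<open>0 \<le> e\<close> by (intro mult_left_mono) auto
    finally show ?thesis .
  qed
  have "D (y 1 r - x) - D (y 0 r - x) = s *\<^sub>R D w"
    by (simp add: linear_diff[OF D, symmetric] linear_scale[OF D, symmetric]) (simp add: y_def)
  then have "f' (y 1 r) - f' (y 0 r) = s *\<^sub>R D w + (R 1 - R 0)"
    by (simp add: R_def algebra_simps)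
  then have "f' (y 1 r) (s *\<^sub>R v) - f' (y 0 r) (s *\<^sub>R v) = (s *\<^sub>R D w + (R 1 - R 0)) (s *\<^sub>R v)"
    by (metis minus_blinfun.rep_eq)
  also have "\<dots> = s\<^sup>2 * D w v + s * (R 1 - R 0) v"
    by (simp add: blinfun.bilinear_simps power2_eq_square algebra_simps)
  finally have eq: "(f (y 1 1) - f (y 0 1)) - (f (y 1 0) - f (y 0 0)) - s\<^sup>2 * D w v = s * (R 1 - R 0) v"
    using mv by simp
  have "\<bar>(R 1 - R 0) v\<bar> \<le> norm (R 1 - R 0) * norm v"
    using norm_blinfun[of "R 1 - R 0" v] by simp
  also have "norm (R 1 - R 0) \<le> e * (s * M) + e * (s * M)"
    using R[of 0] R[of 1] by (intro norm_triangle_le_diff add_mono) auto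
  then have "norm (R 1 - R 0) * norm v \<le> (e * (s * M) + e * (s * M)) * M"
    using M \<open>0 \<le> e\<close> \<open>0 < s\<close> by (intro mult_mono) auto
  finally have "s * \<bar>(R 1 - R 0) v\<bar> \<le> s * ((e * (s * M) + e * (s * M)) * M)"
    using \<open>0 < s\<close> by (intro mult_left_mono) auto
  then have "\<bar>s * (R 1 - R 0) v\<bar> \<le> 2 * e * s\<^sup>2 * M\<^sup>2"
    using \<open>0 < s\<close> by (simp add: abs_mult power2_eq_square algebra_simps)
  then show ?thesis
    unfolding eq[symmetric] M_def by (simp add: y_def algebra_simps)
qed

text \<open>Both \<open>D w v\<close> and \<open>D v w\<close> approximate the same second
  difference divided by \<open>s\<^sup>2\<close>, with an error that is a fixed multiple of the
  tolerance \<open>e\<close>; and \<open>e\<close> is arbitrary.\<close>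

lemma second_derivative_symmetric:
  fixes f :: "'a::real_normed_vector \<Rightarrow> real" and f' :: "'a \<Rightarrow> 'a \<Rightarrow>\<^sub>L real"
  assumes "open U" "x \<in> U"
    and der: "\<And>y. y \<in> U \<Longrightarrow> (f has_derivative blinfun_apply (f' y)) (at y)"
    and der2: "(f' has_derivative D) (at x)"
  shows "blinfun_apply (D v) w = blinfun_apply (D w) v"
proof -
  \<comment> \<open>The summand 1 keeps \<open>M\<close> positive when \<open>v\<close> and
    \<open>w\<close> vanish, since \<open>M\<close> occurs in denominators below.\<close>
  define M where "M = norm v + norm w + 1"
  have "M > 0" by (simp add: M_def add_nonneg_pos)
  have lin: "linear D"
    using der2 has_derivative_linear by blast
  have le: "\<bar>D v w - D w v\<bar> \<le> e * (4 * M\<^sup>2)" if "e > 0" for e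
  proof -
    obtain d1 where d1: "d1 > 0"
      "\<And>y. norm (y - x) < d1 \<Longrightarrow> norm (f' y - f' x - D (y - x)) \<le> e * norm (y - x)"
      using der2 \<open>e > 0\<close> unfolding has_derivative_at_alt by blast
    obtain d2 where d2: "d2 > 0" "ball x d2 \<subseteq> U"
      using assms(1,2) open_contains_ball by blast
    define d where "d = min d1 d2"
    \<comment> \<open>Small enough for the whole parallelogram to lie in the ball of radius
      \<open>d\<close>, where both \<open>der\<close> and the approximation are available.\<close>
    define s where "s = d / (2 * M)"
    have "d > 0" using d1 d2 by (simp add: d_def)
    then have "s > 0" using \<open>M > 0\<close> by (simp add: s_def)
    have "s * (norm v + norm w) \<le> s * M"
      using \<open>s > 0\<close> by (simp add: M_def)
    also have "s * M < d"
      using \<open>d > 0\<close> \<open>M > 0\<close> by (simp add: s_def)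
    finally have sM: "s * (norm v + norm w) < d" .
    have der': "(f has_derivative blinfun_apply (f' y)) (at y)" if "y \<in> ball x d" for y
      using that d2 by (intro der) (auto simp: d_def)
    have app': "norm (f' y - f' x - D (y - x)) \<le> e * norm (y - x)" if "y \<in> ball x d" for y
      using that by (intro d1) (simp add: d_def dist_norm norm_minus_commute[of y])
    define L where "L = norm v + norm w"
    have "\<bar>f (x + s *\<^sub>R v + s *\<^sub>R w) - f (x + s *\<^sub>R v) - f (x + s *\<^sub>R w) + f x - s\<^sup>2 * D w v\<bar>
            \<le> 2 * e * s\<^sup>2 * L\<^sup>2"
      unfolding L_def using second_difference_estimate[OF der' app' lin _ \<open>s > 0\<close> sM] \<open>e > 0\<close> by simp
    moreover have "\<bar>f (x + s *\<^sub>R w + s *\<^sub>R v) - f (x + s *\<^sub>R w) - f (x + s *\<^sub>R v) + f x - s\<^sup>2 * D v w\<bar>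
            \<le> 2 * e * s\<^sup>2 * L\<^sup>2"
      unfolding L_def using second_difference_estimate[where v = w and w = v, OF der' app' lin _ \<open>s > 0\<close>] sM \<open>e > 0\<close>
      by (simp add: add.commute)
    moreover have "x + s *\<^sub>R w + s *\<^sub>R v = x + s *\<^sub>R v + s *\<^sub>R w"
      by simp
    ultimately have "\<bar>s\<^sup>2 * D v w - s\<^sup>2 * D w v\<bar> \<le> 4 * e * s\<^sup>2 * L\<^sup>2"
      by (simp only: abs_le_iff) linarith
    also have "s\<^sup>2 * D v w - s\<^sup>2 * D w v = s\<^sup>2 * (D v w - D w v)"
      by (simp add: algebra_simps)
    finally have "s\<^sup>2 * \<bar>D v w - D w v\<bar> \<le> s\<^sup>2 * (4 * e * L\<^sup>2)"
      by (simp add: abs_mult mult_ac)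
    then have "\<bar>D v w - D w v\<bar> \<le> 4 * e * L\<^sup>2"
      using \<open>s > 0\<close> by simp
    also have "\<dots> \<le> 4 * e * M\<^sup>2"
      using \<open>e > 0\<close> by (intro mult_left_mono power_mono) (auto simp: L_def M_def)
    finally show ?thesis by simp
  qed
  \<comment> \<open>The tolerance is rescaled to absorb the factor \<open>4 * M\<^sup>2\<close>; the
    summand 0 gives the shape that \<open>field_le_epsilon\<close> expects.\<close>
  have "\<bar>D v w - D w v\<bar> \<le> 0 + e" if "e > 0" for e
    using le[of "e / (4 * M\<^sup>2)"] that \<open>M > 0\<close> by simp
  then have "\<bar>D v w - D w v\<bar> \<le> 0"
    using field_le_epsilon by blast
  then show ?thesis by simp
qed

section \<open>Differentiation of vector-valued maps\<close>

text \<open>A basis vector of \<open>'b ^ 'n\<close> is supported in one coordinate, so the inner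
  product with it sees that coordinate only.\<close>

lemma has_derivative_vec_componentwise:
  fixes f :: "'a::real_normed_vector \<Rightarrow> ('b::euclidean_space) ^ 'n::finite"
  assumes "\<And>i. ((\<lambda>x. f x $ i) has_derivative (\<lambda>h. f' h $ i)) (at a within S)"
  shows "(f has_derivative f') (at a within S)"
  unfolding has_derivative_componentwise_within[of f]
  by (auto simp: Basis_vec_def inner_axis intro!: has_derivative_inner_left assms)

text \<open>\<open>has_derivative\<close> includes bounded linearity of the derivative, so it is
  enough that the map is its own derivative at 0, which is checked coordinate by coordinate.\<close>

lemma bounded_linear_vec_smult: "bounded_linear (\<lambda>h::complex. h *s (v :: complex ^ 'n::finite))"
proof -
  have "((\<lambda>h. h *s v) has_derivative (\<lambda>h. h *s v)) (at 0)"
    by (rule has_derivative_vec_componentwise) (auto intro!: derivative_eq_intros)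
  then show ?thesis by (rule has_derivative_bounded_linear)
qed

lemma bounded_linear_smult_vec: "bounded_linear (\<lambda>v :: complex ^ 'n::finite. (c::complex) *s v)"
proof -
  have "((\<lambda>v :: complex ^ 'n. c *s v) has_derivative (\<lambda>v. c *s v)) (at 0)"
    by (rule has_derivative_vec_componentwise)
      (auto intro!: derivative_eq_intros bounded_linear.has_derivative[OF bounded_linear_vec_nth])
  then show ?thesis by (rule has_derivative_bounded_linear)
qed

lemma holomorphic_vec_has_derivative:
  fixes \<phi> :: "complex \<Rightarrow> complex ^ 'n::finite"
  assumes "holomorphic_vec_on \<phi> S" "open S" "\<zeta> \<in> S"
  shows "(\<phi> has_derivative (\<lambda>h. h *s (\<chi> i. deriv (\<lambda>\<zeta>. \<phi> \<zeta> $ i) \<zeta>))) (at \<zeta>)"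
proof (rule has_derivative_vec_componentwise)
  fix i
  have "(\<lambda>\<zeta>. \<phi> \<zeta> $ i) holomorphic_on S"
    using assms by (simp add: holomorphic_vec_on_def)
  then have "((\<lambda>\<zeta>. \<phi> \<zeta> $ i) has_field_derivative deriv (\<lambda>\<zeta>. \<phi> \<zeta> $ i) \<zeta>) (at \<zeta>)"
    using assms holomorphic_derivI by blast
  then show "((\<lambda>\<zeta>. \<phi> \<zeta> $ i) has_derivative (\<lambda>h. (h *s (\<chi> i. deriv (\<lambda>\<zeta>. \<phi> \<zeta> $ i) \<zeta>)) $ i)) (at \<zeta>)"
    by (simp add: has_field_derivative_def mult_commute_abs)
qed

section \<open>Pluriharmonic functions along holomorphic discs\<close>

text \<open>Links the iterated \<open>deriv\<close> in \<open>laplacian\<close> to the second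
  derivative as a bilinear form.\<close>

lemma second_deriv_along_line:
  fixes f :: "'a::real_normed_vector \<Rightarrow> real" and f' :: "'a \<Rightarrow> 'a \<Rightarrow>\<^sub>L real"
  assumes "open U" "p \<in> U"
    and der: "\<And>y. y \<in> U \<Longrightarrow> (f has_derivative blinfun_apply (f' y)) (at y)"
    and der2: "(f' has_derivative blinfun_apply D) (at p)"
  shows "(deriv ^^ 2) (\<lambda>t. f (p + t *\<^sub>R v)) 0 = D v v"
proof -
  have "open ((\<lambda>t::real. p + t *\<^sub>R v) -` U)"
    using \<open>open U\<close> by (intro continuous_open_vimage continuous_intros)
  moreover have "(0::real) \<in> (\<lambda>t. p + t *\<^sub>R v) -` U"
    using \<open>p \<in> U\<close> by simp
  ultimately have ev: "eventually (\<lambda>t::real. p + t *\<^sub>R v \<in> U) (nhds 0)"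
    by (auto simp: eventually_nhds)
  have d1: "deriv (\<lambda>t. f (p + t *\<^sub>R v)) t = f' (p + t *\<^sub>R v) v" if "p + t *\<^sub>R v \<in> U" for t
  proof -
    have "((\<lambda>t. p + t *\<^sub>R v) has_derivative (\<lambda>h. h *\<^sub>R v)) (at t)"
      by (auto intro!: derivative_eq_intros)
    from has_derivative_compose[OF this der[OF that]]
    have "((\<lambda>t. f (p + t *\<^sub>R v)) has_real_derivative f' (p + t *\<^sub>R v) v) (at t)"
      by (simp add: has_field_derivative_def blinfun.bilinear_simps mult_commute_abs)
    then show ?thesis by (rule DERIV_imp_deriv)
  qed
  \<comment> \<open>The formula \<open>d1\<close> holds only while the line stays in
    \<open>U\<close>, but the outer derivative at 0 depends only on values near 0.\<close>
  have "deriv (deriv (\<lambda>t. f (p + t *\<^sub>R v))) 0 = deriv (\<lambda>t. f' (p + t *\<^sub>R v) v) 0"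
    using ev by (intro deriv_cong_ev eventually_mono[OF ev] d1) auto
  also have "\<dots> = D v v"
  proof (rule DERIV_imp_deriv)
    have "((\<lambda>t. p + t *\<^sub>R v) has_derivative (\<lambda>h. h *\<^sub>R v)) (at 0)"
      by (auto intro!: derivative_eq_intros)
    moreover have "(f' has_derivative blinfun_apply D) (at (p + 0 *\<^sub>R v))"
      using der2 by simp
    ultimately have "((\<lambda>t. f' (p + t *\<^sub>R v)) has_derivative (\<lambda>h. D (h *\<^sub>R v))) (at 0)"
      by (rule has_derivative_compose)
    then have "((\<lambda>t. f' (p + t *\<^sub>R v) v) has_derivative (\<lambda>h. D (h *\<^sub>R v) v)) (at 0)"
      by (rule bounded_linear.has_derivative[OF blinfun.bounded_linear_left])
    then show "((\<lambda>t. f' (p + t *\<^sub>R v) v) has_real_derivative D v v) (at 0)"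
      by (simp add: has_field_derivative_def blinfun.bilinear_simps mult_commute_abs)
  qed
  finally show ?thesis by (simp add: numeral_2_eq_2)
qed

text \<open>The left side is the Laplacian at 0 of the restriction to the complex line through
  \<open>p\<close> in direction \<open>v\<close>: the real basis 1, \<i> of that line gives the
  directions \<open>v\<close> and \<open>\<i> *s v\<close>.\<close>

lemma pluriharmonic_on_second_derivative:
  fixes f :: "complex ^ 'n::finite \<Rightarrow> real" and f' :: "complex ^ 'n \<Rightarrow> (complex ^ 'n) \<Rightarrow>\<^sub>L real"
  assumes "pluriharmonic_on f \<Omega>" "p \<in> \<Omega>"
    and der: "\<And>y. y \<in> \<Omega> \<Longrightarrow> (f has_derivative blinfun_apply (f' y)) (at y)"
    and der2: "(f' has_derivative blinfun_apply D) (at p)"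
  shows "D v v + D (\<i> *s v) (\<i> *s v) = 0"
proof -
  have "open \<Omega>" using assms(1) by (simp add: pluriharmonic_on_def)
  have line: "(deriv ^^ 2) (\<lambda>t. f (p + (t *\<^sub>R c) *s v)) 0 = D (c *s v) (c *s v)" for c :: complex
    using second_deriv_along_line[OF \<open>open \<Omega>\<close> \<open>p \<in> \<Omega>\<close> der der2, of "c *s v"]
    unfolding linear_scale[OF bounded_linear.linear[OF bounded_linear_vec_smult]] .
  have "laplacian (\<lambda>\<zeta>. f (p + \<zeta> *s v)) 0 = 0"
  proof -
    have "harmonic_on (\<lambda>\<zeta>. f (p + \<zeta> *s v)) {\<zeta>. p + \<zeta> *s v \<in> \<Omega>}"
      using assms(1) unfolding pluriharmonic_on_def by blast
    moreover have "0 \<in> {\<zeta>. p + \<zeta> *s v \<in> \<Omega>}"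
      using \<open>p \<in> \<Omega>\<close> by simp
    ultimately show ?thesis
      unfolding harmonic_on_def by blast
  qed
  moreover have "laplacian (\<lambda>\<zeta>. f (p + \<zeta> *s v)) 0 = D (1 *s v) (1 *s v) + D (\<i> *s v) (\<i> *s v)"
    by (simp add: laplacian_def Basis_complex_def line del: scaleR_conv_of_real vector_smult_lid)
  ultimately show ?thesis by simp
qed

text \<open>
  With \<open>A\<close> and \<open>B\<close> the derivatives of \<open>f\<close> at \<open>\<phi> \<zeta>\<close> in the directions \<open>\<phi>' \<zeta>\<close> and \<open>\<i> \<phi>' \<zeta>\<close>,
  the function \<open>A - \<i> B\<close> is holomorphic; \<open>\<psi>\<close> is its primitive.
\<close>

lemma pluriharmonic_on_disc_conjugate:
  fixes f :: "complex ^ 'n::finite \<Rightarrow> real" and \<phi> :: "complex \<Rightarrow> complex ^ 'n"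
  assumes plh: "pluriharmonic_on f \<Omega>" and hol: "holomorphic_vec_on \<phi> S"
    and S: "open S" "convex S" "c \<in> S" and sub: "\<phi> ` S \<subseteq> \<Omega>"
  obtains \<psi> where "\<psi> holomorphic_on S" "\<And>\<zeta>. \<zeta> \<in> S \<Longrightarrow> Re (\<psi> \<zeta>) = f (\<phi> \<zeta>)"
    "\<psi> c = complex_of_real (f (\<phi> c))"
proof -
  have "open \<Omega>" using plh by (simp add: pluriharmonic_on_def)
  obtain f' :: "complex ^ 'n \<Rightarrow> (complex ^ 'n) \<Rightarrow>\<^sub>L real"
    and f'' :: "complex ^ 'n \<Rightarrow> (complex ^ 'n) \<Rightarrow>\<^sub>L ((complex ^ 'n) \<Rightarrow>\<^sub>L real)"
    where f': "\<And>x. x \<in> \<Omega> \<Longrightarrow> (f has_derivative blinfun_apply (f' x)) (at x)"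
      and f'': "\<And>x. x \<in> \<Omega> \<Longrightarrow> (f' has_derivative blinfun_apply (f'' x)) (at x)"
    using plh unfolding pluriharmonic_on_def C2_on_def by blast
  define \<phi>' where "\<phi>' \<zeta> = (\<chi> i. deriv (\<lambda>\<zeta>. \<phi> \<zeta> $ i) \<zeta>)" for \<zeta>
  have d\<phi>: "(\<phi> has_derivative (\<lambda>h. h *s \<phi>' \<zeta>)) (at \<zeta>)" if "\<zeta> \<in> S" for \<zeta>
    unfolding \<phi>'_def using holomorphic_vec_has_derivative[OF hol \<open>open S\<close> that] .
  have "holomorphic_vec_on \<phi>' S"
    using hol \<open>open S\<close> by (auto simp: holomorphic_vec_on_def \<phi>'_def intro: holomorphic_deriv)
  define \<phi>'' where "\<phi>'' \<zeta> = (\<chi> i. deriv (\<lambda>\<zeta>. \<phi>' \<zeta> $ i) \<zeta>)" for \<zeta>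
  have d\<phi>': "(\<phi>' has_derivative (\<lambda>h. h *s \<phi>'' \<zeta>)) (at \<zeta>)" if "\<zeta> \<in> S" for \<zeta>
    unfolding \<phi>''_def using holomorphic_vec_has_derivative[OF \<open>holomorphic_vec_on \<phi>' S\<close> \<open>open S\<close> that] .
  define g where "g \<zeta> = complex_of_real (f' (\<phi> \<zeta>) (\<phi>' \<zeta>)) - \<i> * complex_of_real (f' (\<phi> \<zeta>) (\<i> *s \<phi>' \<zeta>))" for \<zeta>
  have "g holomorphic_on S"
    unfolding holomorphic_on_open[OF \<open>open S\<close>]
  proof
    fix \<zeta> assume "\<zeta> \<in> S"
    then have \<Omega>: "\<phi> \<zeta> \<in> \<Omega>" using sub by auto
    define D where "D = f'' (\<phi> \<zeta>)"
    define p where "p = f' (\<phi> \<zeta>)"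
    define v where "v = \<phi>' \<zeta>"
    define w where "w = \<phi>'' \<zeta>"
    have df: "((\<lambda>\<zeta>. f' (\<phi> \<zeta>)) has_derivative (\<lambda>h. D (h *s v))) (at \<zeta>)"
      unfolding D_def v_def using has_derivative_compose[OF d\<phi>[OF \<open>\<zeta> \<in> S\<close>] f''[OF \<Omega>]] .
    have A: "((\<lambda>\<zeta>. f' (\<phi> \<zeta>) (\<phi>' \<zeta>)) has_derivative (\<lambda>h. p (h *s w) + D (h *s v) v)) (at \<zeta>)"
      unfolding p_def v_def w_def
      using blinfun.FDERIV[OF df d\<phi>'[OF \<open>\<zeta> \<in> S\<close>]] unfolding v_def .
    have "((\<lambda>\<zeta>. \<i> *s \<phi>' \<zeta>) has_derivative (\<lambda>h. \<i> *s (h *s w))) (at \<zeta>)"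
      unfolding w_def
      by (rule bounded_linear.has_derivative[OF bounded_linear_smult_vec d\<phi>'[OF \<open>\<zeta> \<in> S\<close>]])
    from blinfun.FDERIV[OF df this]
    have B: "((\<lambda>\<zeta>. f' (\<phi> \<zeta>) (\<i> *s \<phi>' \<zeta>)) has_derivative
        (\<lambda>h. p (\<i> *s (h *s w)) + D (h *s v) (\<i> *s v))) (at \<zeta>)"
      unfolding p_def v_def .
    define g' where "g' h = complex_of_real (p (h *s w) + D (h *s v) v) -
       \<i> * complex_of_real (p (\<i> *s (h *s w)) + D (h *s v) (\<i> *s v))" for h
    have dg: "(g has_derivative g') (at \<zeta>)"
      unfolding g_def g'_def
      by (intro has_derivative_diff has_derivative_mult_right
          bounded_linear.has_derivative[OF bounded_linear_of_real A]
          bounded_linear.has_derivative[OF bounded_linear_of_real B])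
    have sym: "D v (\<i> *s v) = D (\<i> *s v) v"
      using second_derivative_symmetric[OF \<open>open \<Omega>\<close> \<Omega> f' f''[OF \<Omega>]] by (simp add: D_def)
    have lap: "D (\<i> *s v) (\<i> *s v) = - D v v"
      using pluriharmonic_on_second_derivative[OF plh \<Omega> f' f''[OF \<Omega>], of v] by (simp add: D_def)
    have pw: "p (- w) = - p w"
      by (simp add: blinfun.bilinear_simps)
    have ii: "\<i> *s (\<i> *s w) = - w"
      by (simp add: vector_smult_assoc vec_eq_iff)
    \<comment> \<open>The Cauchy-Riemann equation for \<open>g\<close>. The terms in
      \<open>w\<close> match because \<i> squares to -1; among the terms in \<open>v\<close>,
      \<open>sym\<close> matches the real parts and \<open>lap\<close> the imaginary ones.\<close>
    have CR: "g' \<i> = \<i> * g' 1"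
      by (simp add: g'_def sym lap ii pw algebra_simps)
    \<comment> \<open>A real-linear map that commutes with multiplication by \<i> is complex
      linear.\<close>
    have "g' h = g' 1 * h" for h
    proof -
      have lin: "linear g'" using dg has_derivative_linear by blast
      have "h = Re h *\<^sub>R 1 + Im h *\<^sub>R \<i>"
        by (simp add: complex_eq_iff)
      then have "g' h = Re h *\<^sub>R g' 1 + Im h *\<^sub>R g' \<i>"
        using linear_add[OF lin] linear_scale[OF lin] by metis
      also have "\<dots> = g' 1 * (Re h *\<^sub>R 1 + Im h *\<^sub>R \<i>)"
        by (simp add: CR algebra_simps)
      finally show ?thesis
        using \<open>h = Re h *\<^sub>R 1 + Im h *\<^sub>R \<i>\<close> by simp
    qed
    then have "g' = (*) (g' 1)" by (rule ext)
    then have "(g has_field_derivative g' 1) (at \<zeta>)"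
      using dg by (metis has_field_derivative_def)
    then show "\<exists>f'. (g has_field_derivative f') (at \<zeta>)" ..
  qed
  then obtain G where "\<And>\<zeta>. \<zeta> \<in> S \<Longrightarrow> (G has_field_derivative g \<zeta>) (at \<zeta> within S)"
    using holomorphic_convex_primitive'[OF \<open>convex S\<close> \<open>open S\<close>] by blast
  then have G: "(G has_field_derivative g \<zeta>) (at \<zeta>)" if "\<zeta> \<in> S" for \<zeta>
    using that S at_within_open by metis
  \<comment> \<open>The constant of integration is chosen so that the value at \<open>c\<close> is
    \<open>f (\<phi> c)\<close>, with imaginary part 0.\<close>
  define \<psi> where "\<psi> \<zeta> = G \<zeta> - G c + complex_of_real (f (\<phi> c))" for \<zeta>
  have d\<psi>: "(\<psi> has_field_derivative g \<zeta>) (at \<zeta>)" if "\<zeta> \<in> S" for \<zeta>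
    unfolding \<psi>_def using G[OF that] by (auto intro!: derivative_eq_intros)
  have dR: "((\<lambda>\<zeta>. Re (\<psi> \<zeta>) - f (\<phi> \<zeta>)) has_derivative (\<lambda>h. 0)) (at \<zeta> within S)" if "\<zeta> \<in> S" for \<zeta>
  proof -
    have \<Omega>: "\<phi> \<zeta> \<in> \<Omega>" using that sub by auto
    have "((\<lambda>\<zeta>. Re (\<psi> \<zeta>)) has_derivative (\<lambda>h. Re (g \<zeta> * h))) (at \<zeta>)"
      using bounded_linear.has_derivative[OF bounded_linear_Re d\<psi>[OF that, unfolded has_field_derivative_def]] .
    from has_derivative_diff[OF this has_derivative_compose[OF d\<phi>[OF that] f'[OF \<Omega>]]]
    have "((\<lambda>\<zeta>. Re (\<psi> \<zeta>) - f (\<phi> \<zeta>)) has_derivative (\<lambda>h. Re (g \<zeta> * h) - f' (\<phi> \<zeta>) (h *s \<phi>' \<zeta>))) (at \<zeta>)" .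
    \<comment> \<open>Splitting \<open>h\<close> into real and imaginary parts turns the derivative
      of \<open>f\<close> along the disc into \<open>Re h\<close> times A plus \<open>Im h\<close>
      times B, which is the real part of (A - \<i> B) \<open>h\<close>.\<close>
    moreover have "f' (\<phi> \<zeta>) (h *s \<phi>' \<zeta>) = Re (g \<zeta> * h)" for h
    proof -
      have "h *s \<phi>' \<zeta> = Re h *\<^sub>R \<phi>' \<zeta> + Im h *\<^sub>R (\<i> *s \<phi>' \<zeta>)"
        by (simp add: vec_eq_iff complex_eq_iff algebra_simps)
      then show ?thesis
        by (simp add: g_def blinfun.bilinear_simps algebra_simps)
    qed
    ultimately show ?thesis
      using has_derivative_at_withinI by simp
  qed
  have "Re (\<psi> \<zeta>) = f (\<phi> \<zeta>)" if "\<zeta> \<in> S" for \<zeta>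
  proof -
    have "Re (\<psi> \<zeta>) - f (\<phi> \<zeta>) = Re (\<psi> c) - f (\<phi> c)"
      using has_derivative_zero_unique[OF \<open>convex S\<close> dR that \<open>c \<in> S\<close>] by simp
    then show ?thesis by (simp add: \<psi>_def)
  qed
  moreover have "\<psi> holomorphic_on S"
    unfolding holomorphic_on_open[OF \<open>open S\<close>] using d\<psi> by blast
  ultimately show ?thesis
    using that by (simp add: \<psi>_def)
qed

section \<open>Comparison of the Kobayashi norms\<close>

lemma kobayashi_norm_leI:
  assumes "holomorphic_vec_on \<phi> (ball 0 1)" "\<phi> ` ball 0 1 \<subseteq> G" "\<phi> 0 = p"
    "frechet_derivative \<phi> (at 0) h = v"
  shows "kobayashi_norm G p v \<le> ennreal (cmod h)"
  unfolding kobayashi_norm_def using assms by (intro Inf_lower) blast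

text \<open>Supplies the rescaling that makes a tangent real; the quotient of \<open>Re c\<close> by
  \<open>c\<close> has modulus at most 1 because the real part is bounded by the modulus.\<close>

lemma Re_eq_contraction_mult:
  obtains s :: complex where "cmod s \<le> 1" "s * c = complex_of_real (Re c)"
proof (cases "c = 0")
  case True
  then show ?thesis using that[of 1] by simp
next
  case False
  then show ?thesis
    using that[of "complex_of_real (Re c) / c"] abs_Re_le_cmod[of c] by (simp add: norm_divide)
qed

text \<open>Every disc that competes for the norm on the right yields a disc in the strip square
  with the same \<open>h\<close>, so the infimum on the left is no larger.\<close>

lemma kobayashi_norm_strip_square_le:
  fixes u :: "complex ^ 'n::finite \<Rightarrow> real ^ 2"
  assumes u: "u ` \<Omega> \<subseteq> interval_square a b"
    and plh: "\<And>i. pluriharmonic_on (\<lambda>x. u x $ i) \<Omega>"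
    and du: "(u has_derivative u') (at p)"
  shows "kobayashi_norm (strip_square a b) (complexify (u p)) (complexify (u' v)) \<le> kobayashi_norm \<Omega> p v"
proof -
  have "kobayashi_norm (strip_square a b) (complexify (u p)) (complexify (u' v)) \<le> ennreal (cmod h)"
    if hol: "holomorphic_vec_on \<phi> (ball 0 1)" and sub: "\<phi> ` ball 0 1 \<subseteq> \<Omega>"
      and p: "\<phi> 0 = p" and v: "frechet_derivative \<phi> (at 0) h = v" for h and \<phi> :: "complex \<Rightarrow> complex ^ 'n"
  proof -
    define U :: "complex set" where "U = ball 0 1"
    have U: "open U" "convex U" "0 \<in> U" by (auto simp: U_def)
    have "\<exists>\<psi>. \<psi> holomorphic_on U \<and> (\<forall>\<zeta>\<in>U. Re (\<psi> \<zeta>) = u (\<phi> \<zeta>) $ i) \<and>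
            \<psi> 0 = complex_of_real (u p $ i)" for i
    proof -
      obtain \<psi> where "\<psi> holomorphic_on U" "\<And>\<zeta>. \<zeta> \<in> U \<Longrightarrow> Re (\<psi> \<zeta>) = u (\<phi> \<zeta>) $ i"
        "\<psi> 0 = complex_of_real (u (\<phi> 0) $ i)"
        using pluriharmonic_on_disc_conjugate[OF plh hol[folded U_def] U sub[folded U_def]] by blast
      then show ?thesis using p by blast
    qed
    then obtain \<psi> where \<psi>: "\<And>i. \<psi> i holomorphic_on U" "\<And>i \<zeta>. \<zeta> \<in> U \<Longrightarrow> Re (\<psi> i \<zeta>) = u (\<phi> \<zeta>) $ i"
      "\<And>i. \<psi> i 0 = complex_of_real (u p $ i)"
      by metis
    have "\<exists>s. cmod s \<le> 1 \<and> s * (deriv (\<psi> i) 0 * h) = complex_of_real (Re (deriv (\<psi> i) 0 * h))" for i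
      using Re_eq_contraction_mult[of "deriv (\<psi> i) 0 * h"] by blast
    then obtain s where s: "\<And>i. cmod (s i) \<le> 1"
        "\<And>i. s i * (deriv (\<psi> i) 0 * h) = complex_of_real (Re (deriv (\<psi> i) 0 * h))"
      by metis
    have sU: "s i * \<zeta> \<in> U" if "\<zeta> \<in> U" for i \<zeta>
    proof -
      have "cmod (s i) * cmod \<zeta> \<le> 1 * cmod \<zeta>"
        using s by (intro mult_right_mono) auto
      then show ?thesis using that by (simp add: U_def norm_mult)
    qed
    \<comment> \<open>The factor \<open>s i\<close> acts on the variable, not on the value: the
      centre is kept, the disc is mapped into itself by \<open>sU\<close>, and the derivative at 0
      is multiplied by \<open>s i\<close>.\<close>
    define \<kappa> :: "complex \<Rightarrow> complex ^ 2" where "\<kappa> \<zeta> = (\<chi> i. \<psi> i (s i * \<zeta>))" for \<zeta>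
    have d\<kappa>: "((\<lambda>\<zeta>. \<kappa> \<zeta> $ i) has_field_derivative deriv (\<psi> i) (s i * \<zeta>) * s i) (at \<zeta>)"
      if "\<zeta> \<in> U" for i \<zeta>
    proof -
      have "(\<psi> i has_field_derivative deriv (\<psi> i) (s i * \<zeta>)) (at (s i * \<zeta>))"
        using holomorphic_derivI[OF \<psi>(1) U(1) sU[OF that]] .
      moreover have "((\<lambda>\<zeta>. s i * \<zeta>) has_field_derivative s i) (at \<zeta>)"
        by (auto intro!: derivative_eq_intros)
      ultimately have "((\<lambda>\<zeta>. \<psi> i (s i * \<zeta>)) has_field_derivative deriv (\<psi> i) (s i * \<zeta>) * s i) (at \<zeta>)"
        by (rule DERIV_chain2)
      then show ?thesis by (simp add: \<kappa>_def)
    qed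
    have hol\<kappa>: "holomorphic_vec_on \<kappa> U"
      unfolding holomorphic_vec_on_def holomorphic_on_open[OF U(1)] using d\<kappa> by blast
    have sub\<kappa>: "\<kappa> ` U \<subseteq> strip_square a b"
    proof clarify
      fix \<zeta> assume "\<zeta> \<in> U"
      \<comment> \<open>The coordinates of \<open>\<kappa> \<zeta>\<close> come from different
        points \<open>s i * \<zeta>\<close>, so they need not belong to one value of
        \<open>u\<close>. Each is still in the strip, and membership in \<open>strip_square\<close>
        is tested coordinatewise.\<close>
      then have "u (\<phi> (s i * \<zeta>)) \<in> interval_square a b" for i
        using u sub sU unfolding U_def by blast
      then show "\<kappa> \<zeta> \<in> strip_square a b"
        using \<psi>(2)[OF sU[OF \<open>\<zeta> \<in> U\<close>]]
        by (auto simp: strip_square_def strip_def interval_square_def einterval_def \<kappa>_def)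
    qed
    have \<kappa>0: "\<kappa> 0 = complexify (u p)"
      by (simp add: \<kappa>_def \<psi>(3) complexify_def)
    have d\<kappa>0: "frechet_derivative \<kappa> (at 0) h = complexify (u' v)"
    proof -
      have "(\<kappa> has_derivative (\<lambda>h. h *s (\<chi> i. deriv (\<psi> i) 0 * s i))) (at 0)"
      proof (rule has_derivative_vec_componentwise)
        fix i
        show "((\<lambda>\<zeta>. \<kappa> \<zeta> $ i) has_derivative (\<lambda>h. (h *s (\<chi> i. deriv (\<psi> i) 0 * s i)) $ i)) (at 0)"
          using d\<kappa>[OF U(3), of i] by (simp add: has_field_derivative_def mult_commute_abs)
      qed
      then have "frechet_derivative \<kappa> (at 0) h = h *s (\<chi> i. deriv (\<psi> i) 0 * s i)"
        by (simp add: frechet_derivative_at[symmetric])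
      moreover have "h * (deriv (\<psi> i) 0 * s i) = complex_of_real (u' v $ i)" for i
      proof -
        have "\<phi> differentiable at 0"
          using holomorphic_vec_has_derivative[OF hol _, of 0] differentiable_def by force
        then have "(\<phi> has_derivative frechet_derivative \<phi> (at 0)) (at 0)"
          using frechet_derivative_works by blast
        from has_derivative_compose[OF this, of u u'] du p
        have "((\<lambda>\<zeta>. u (\<phi> \<zeta>) $ i) has_derivative (\<lambda>h. u' (frechet_derivative \<phi> (at 0) h) $ i)) (at 0)"
          by (intro bounded_linear.has_derivative[OF bounded_linear_vec_nth]) auto
        \<comment> \<open>A second expression for the derivative just found by the chain rule;
          uniqueness identifies the real part of the tangent of \<open>\<psi> i\<close> with a
          coordinate of \<open>u' v\<close>.\<close>
        moreover have "((\<lambda>\<zeta>. u (\<phi> \<zeta>) $ i) has_derivative (\<lambda>h. Re (deriv (\<psi> i) 0 * h))) (at 0)"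
        proof (rule has_derivative_transform_within_open[OF _ U(1) U(3)])
          show "((\<lambda>\<zeta>. Re (\<psi> i \<zeta>)) has_derivative (\<lambda>h. Re (deriv (\<psi> i) 0 * h))) (at 0)"
            using holomorphic_derivI[OF \<psi>(1) U(1) U(3)]
            by (intro bounded_linear.has_derivative[OF bounded_linear_Re]) (simp add: has_field_derivative_def)
        qed (use \<psi>(2) in auto)
        ultimately have "u' (frechet_derivative \<phi> (at 0) h) $ i = Re (deriv (\<psi> i) 0 * h)"
          by (metis has_derivative_unique)
        then show ?thesis
          using s(2)[of i] v by (simp add: mult_ac)
      qed
      ultimately show ?thesis
        by (simp add: complexify_def vec_eq_iff)
    qed
    show ?thesis
      using kobayashi_norm_leI[OF hol\<kappa>[unfolded U_def] sub\<kappa>[unfolded U_def] \<kappa>0 d\<kappa>0] .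
  qed
  then show ?thesis
    unfolding kobayashi_norm_def[of \<Omega>] by (intro Inf_greatest) blast
qed

section \<open>From norms to distances\<close>

lemma bounded_linear_complexify: "bounded_linear (complexify :: real ^ 'n::finite \<Rightarrow> complex ^ 'n)"
proof -
  have "(complexify has_derivative (complexify :: real ^ 'n \<Rightarrow> complex ^ 'n)) (at 0)"
    by (rule has_derivative_vec_componentwise)
      (auto simp: complexify_def intro!: derivative_eq_intros bounded_linear.has_derivative[OF bounded_linear_vec_nth])
  then show ?thesis by (rule has_derivative_bounded_linear)
qed

text \<open>Continuity of the derivative is needed so that \<open>u\<close> carries valid paths to
  valid paths. It holds since the derivative of each coordinate is itself differentiable; the
  coordinate derivatives are then stacked into one bounded linear map.\<close>

lemma C2_on_vec_imp_C1:
  fixes u :: "'a::euclidean_space \<Rightarrow> real ^ 'n::finite"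
  assumes "\<And>i. C2_on (\<lambda>x. u x $ i) \<Omega>"
  obtains u' :: "'a \<Rightarrow> 'a \<Rightarrow>\<^sub>L (real ^ 'n)"
    where "\<And>x. x \<in> \<Omega> \<Longrightarrow> (u has_derivative blinfun_apply (u' x)) (at x)" "continuous_on \<Omega> u'"
proof -
  have "\<exists>f' :: 'a \<Rightarrow> 'a \<Rightarrow>\<^sub>L real. (\<forall>x\<in>\<Omega>. ((\<lambda>x. u x $ i) has_derivative blinfun_apply (f' x)) (at x)) \<and>
          continuous_on \<Omega> f'" for i
    using assms[of i] unfolding C2_on_def
    by (metis has_derivative_continuous continuous_at_imp_continuous_on)
  then obtain f' :: "'n \<Rightarrow> 'a \<Rightarrow> 'a \<Rightarrow>\<^sub>L real"
    where f': "\<And>i x. x \<in> \<Omega> \<Longrightarrow> ((\<lambda>x. u x $ i) has_derivative blinfun_apply (f' i x)) (at x)"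
      and cont: "\<And>i. continuous_on \<Omega> (f' i)"
    by metis
  define L where "L x h = (\<chi> i. f' i x h)" for x h
  have "(L x has_derivative L x) (at 0)" for x
    by (rule has_derivative_vec_componentwise) (auto simp: L_def intro!: derivative_eq_intros)
  then have "bounded_linear (L x)" for x
    using has_derivative_bounded_linear by blast
  then have L: "blinfun_apply (Blinfun (L x)) = L x" for x
    by (rule bounded_linear_Blinfun_apply)
  show ?thesis
  proof
    show "(u has_derivative blinfun_apply (Blinfun (L x))) (at x)" if "x \<in> \<Omega>" for x
      unfolding L using f'[OF that] by (intro has_derivative_vec_componentwise) (simp add: L_def)
    show "continuous_on \<Omega> (\<lambda>x. Blinfun (L x))"
      unfolding L_def[abs_def]
      by (intro continuous_on_blinfun_componentwise)
        (use L in \<open>auto simp: L_def[abs_def] intro!: continuous_intros cont\<close>)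
  qed
qed

lemma Kob_le_path_integral:
  assumes "valid_path \<gamma>" "path_image \<gamma> \<subseteq> G"
  shows "Kob G (pathstart \<gamma>) (pathfinish \<gamma>) \<le>
    (\<integral>\<^sup>+ t \<in> {0..1}. kobayashi_norm G (\<gamma> t) (vector_derivative \<gamma> (at t)) \<partial>lborel)"
  unfolding Kob_def using assms by (intro Inf_lower CollectI exI[of _ \<gamma>] conjI) simp_all

text \<open>Integrating the pointwise inequality along a path \<open>\<gamma>\<close> bounds the
  length of \<open>F \<circ> \<gamma>\<close> by that of \<open>\<gamma>\<close>. \<open>F\<close>
  is only real differentiable, so the chain rule is the real one.\<close>

lemma Kob_le_of_kobayashi_norm_le:
  fixes F :: "complex ^ 'n::finite \<Rightarrow> complex ^ 'm::finite"
  assumes F': "\<And>x. x \<in> \<Omega> \<Longrightarrow> (F has_derivative blinfun_apply (F' x)) (at x)"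
    and cont: "continuous_on \<Omega> F'"
    and FG: "F ` \<Omega> \<subseteq> G"
    and le: "\<And>x v. x \<in> \<Omega> \<Longrightarrow> kobayashi_norm G (F x) (F' x v) \<le> kobayashi_norm \<Omega> x v"
  shows "Kob G (F z) (F w) \<le> Kob \<Omega> z w"
  unfolding Kob_def[of \<Omega>]
proof (rule Inf_greatest, clarify)
  fix \<gamma> assume \<gamma>: "valid_path \<gamma>" "path_image \<gamma> \<subseteq> \<Omega>" 
  have \<gamma>\<Omega>: "\<gamma> t \<in> \<Omega>" if "t \<in> {0..1}" for t
    using \<gamma>(2) that by (auto simp: path_image_def)
  obtain S where "finite S" and S: "\<gamma> C1_differentiable_on {0..1} - S"
    using \<gamma>(1) by (auto simp: valid_path_def piecewise_C1_differentiable_on_def)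
  have "path \<gamma>" using \<gamma>(1) by (rule valid_path_imp_path)
  then have c\<gamma>: "continuous_on {0..1} \<gamma>" by (simp add: path_def)
  obtain D where D: "\<And>t. t \<in> {0..1} - S \<Longrightarrow> (\<gamma> has_vector_derivative D t) (at t)"
    and cD: "continuous_on ({0..1} - S) D"
    using S unfolding C1_differentiable_on_def by blast
  have dF: "((F \<circ> \<gamma>) has_vector_derivative F' (\<gamma> t) (D t)) (at t)" if "t \<in> {0..1} - S" for t
  proof -
    have "\<gamma> t \<in> \<Omega>" using \<gamma>\<Omega> that by blast
    from has_derivative_compose[OF D[OF that, unfolded has_vector_derivative_def] F'[OF this]]
    show ?thesis by (simp add: has_vector_derivative_def o_def blinfun.bilinear_simps)
  qed
  have "F \<circ> \<gamma> C1_differentiable_on {0..1} - S"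
    unfolding C1_differentiable_on_def
  proof (intro exI conjI ballI)
    show "((F \<circ> \<gamma>) has_vector_derivative F' (\<gamma> t) (D t)) (at t)" if "t \<in> {0..1} - S" for t
      using dF that .
    show "continuous_on ({0..1} - S) (\<lambda>t. F' (\<gamma> t) (D t))"
      using \<gamma>\<Omega> by (intro continuous_intros cD continuous_on_compose2[OF cont]
          continuous_on_subset[OF c\<gamma>]) auto
  qed
  moreover have "continuous_on {0..1} (F \<circ> \<gamma>)"
  proof (rule continuous_on_compose[OF c\<gamma>])
    show "continuous_on (\<gamma> ` {0..1}) F"
      using F' \<gamma>\<Omega> has_derivative_continuous by (intro continuous_at_imp_continuous_on) blast
  qed
  ultimately have "valid_path (F \<circ> \<gamma>)"
    using \<open>finite S\<close> by (auto simp: valid_path_def piecewise_C1_differentiable_on_def)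
  moreover have "path_image (F \<circ> \<gamma>) \<subseteq> G"
    using FG \<gamma>(2) by (auto simp: path_image_def)
  ultimately have "Kob G (F (pathstart \<gamma>)) (F (pathfinish \<gamma>)) \<le>
      (\<integral>\<^sup>+ t \<in> {0..1}. kobayashi_norm G ((F \<circ> \<gamma>) t) (vector_derivative (F \<circ> \<gamma>) (at t)) \<partial>lborel)"
    using Kob_le_path_integral[of "F \<circ> \<gamma>" G] by (simp add: pathstart_compose pathfinish_compose)
  also have "\<dots> \<le> (\<integral>\<^sup>+ t \<in> {0..1}. kobayashi_norm \<Omega> (\<gamma> t) (vector_derivative \<gamma> (at t)) \<partial>lborel)"
  proof (rule nn_integral_mono_AE)
    have "AE t in lborel. t \<notin> S"
      using \<open>finite S\<close> by (intro AE_not_in finite_imp_null_set_lborel)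
    then show "AE t in lborel.
        kobayashi_norm G ((F \<circ> \<gamma>) t) (vector_derivative (F \<circ> \<gamma>) (at t)) * indicator {0..1} t
        \<le> kobayashi_norm \<Omega> (\<gamma> t) (vector_derivative \<gamma> (at t)) * indicator {0..1} t"
    proof eventually_elim
      case (elim t)
      show ?case
      proof (cases "t \<in> {0..1}")
        case True
        then have t: "t \<in> {0..1} - S" using elim by simp
        then show ?thesis
          using le[OF \<gamma>\<Omega>[OF True], of "D t"] vector_derivative_at[OF dF[OF t]]
            vector_derivative_at[OF D[OF t]] by simp
      qed simp
    qed
  qed
  finally show "Kob G (F (pathstart \<gamma>)) (F (pathfinish \<gamma>)) \<le>
      (\<integral>\<^sup>+ t \<in> {0..1}. kobayashi_norm \<Omega> (\<gamma> t) (vector_derivative \<gamma> (at t)) \<partial>lborel)" .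
qed

theorem theorem10:
  fixes a b :: ereal and u :: "complex ^ 2 \<Rightarrow> real ^ 2" and z w :: "complex ^ 2"
  assumes "- \<infinity> < a" and "a < b" and "b \<le> \<infinity>"
    and "u ` ball 0 1 \<subseteq> interval_square a b"
    and "\<forall>i. pluriharmonic_on (\<lambda>x. u x $ i) (ball 0 1)"
    and "z \<in> ball 0 1" and "w \<in> ball 0 1"
  shows "Kob (strip_square a b) (complexify (u z)) (complexify (u w)) \<le> Kob (ball 0 1) z w"
proof -
  have "C2_on (\<lambda>x. u x $ i) (ball 0 1)" for i
    using assms(5) by (simp add: pluriharmonic_on_def)
  then obtain u' :: "complex ^ 2 \<Rightarrow> (complex ^ 2) \<Rightarrow>\<^sub>L (real ^ 2)"
    where u': "\<And>x. x \<in> ball 0 1 \<Longrightarrow> (u has_derivative blinfun_apply (u' x)) (at x)"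
      and cont: "continuous_on (ball 0 1) u'"
    using C2_on_vec_imp_C1 by blast
  \<comment> \<open>As a bounded linear map, \<open>J\<close> lets the derivative of
    \<open>complexify\<close> after \<open>u\<close> be written as a composition, whose continuity
    follows from that of \<open>u'\<close>.\<close>
  define J :: "(real ^ 2) \<Rightarrow>\<^sub>L (complex ^ 2)" where "J = Blinfun complexify"
  have J: "blinfun_apply J = complexify"
    unfolding J_def by (rule bounded_linear_Blinfun_apply[OF bounded_linear_complexify])
  show ?thesis
  proof (rule Kob_le_of_kobayashi_norm_le)
    show "((\<lambda>x. complexify (u x)) has_derivative blinfun_apply (J o\<^sub>L u' x)) (at x)" if "x \<in> ball 0 1" for x
      using bounded_linear.has_derivative[OF bounded_linear_complexify u'[OF that]]
      by (simp add: blinfun_compose.rep_eq J o_def)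
    show "continuous_on (ball 0 1) (\<lambda>x. J o\<^sub>L u' x)"
      by (intro continuous_intros cont)
    show "(\<lambda>x. complexify (u x)) ` ball 0 1 \<subseteq> strip_square a b"
      using assms(4)
      by (auto simp: strip_square_def strip_def interval_square_def einterval_def complexify_def)
    show "kobayashi_norm (strip_square a b) (complexify (u x)) ((J o\<^sub>L u' x) v) \<le> kobayashi_norm (ball 0 1) x v"
      if "x \<in> ball 0 1" for x v
      using kobayashi_norm_strip_square_le[OF assms(4) _ u'[OF that]] assms(5) by (simp add: J)
  qed
qed

end
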